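(* Let $G(V, E)$ be a graph with $|V| = n$. Suppose for any vertex $ x \in V$ there is another vertex $ u \in V$ such that $V\setminus N(x) \subseteq N(u)$. Then $\mathrm{edim}(G + K_1) = n$. Otherwise, $\mathrm{edim}(G + K_1) = n-1$.
   Context: All graphs are simple, connected and undirected. $N(v)$ denotes the set of vertices adjacent to $v$ (not including $v$). $G + K_1$ is obtained from $G$ by adding one new vertex adjacent to all vertices of $G$. For an edge $e=xy$ and vertex $v$, $d(e,v)=\min\{d(x,v),d(y,v)\}$; $\mathrm{edim}(G)$ is the minimum size of a set $S\subseteq V$ such that any two distinct edges have different distance to some vertex of $S$. *)

theory Defs
  imports "Graph_Theory.Graph_Theory"
begin

text \<open>
  A finite simple undirected graph is a \<^locale>\<open>pair_graph\<close>, that is a finite loop-free symmetric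
  relation on a finite vertex set: every undirected edge is represented by its two opposite arcs.
  Hence the edges proper are the two-element sets of end vertices.
\<close>

definition nbhd :: "'a pair_pre_digraph \<Rightarrow> 'a \<Rightarrow> 'a set" where
  "nbhd G v = {u. (v, u) \<in> parcs G}"

definition uedges :: "'a pair_pre_digraph \<Rightarrow> 'a set set" where
  "uedges G = {{x, y} | x y. (x, y) \<in> parcs G}"

text \<open>
  The library's shortest-path weight with unit weights: the least length of a walk, and infinity if
  there is none.
\<close>

definition vdist :: "'a pair_pre_digraph \<Rightarrow> 'a \<Rightarrow> 'a \<Rightarrow> ereal" where
  "vdist G u v = wf_digraph.\<mu> (with_proj G) (\<lambda>_. 1) u v"

definition edist :: "'a pair_pre_digraph \<Rightarrow> 'a set \<Rightarrow> 'a \<Rightarrow> ereal" where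
  "edist G e v = Min ((\<lambda>x. vdist G x v) ` e)"

definition edge_resolving :: "'a pair_pre_digraph \<Rightarrow> 'a set \<Rightarrow> bool" where
  "edge_resolving G S \<longleftrightarrow> S \<subseteq> pverts G \<and>
     (\<forall>e \<in> uedges G. \<forall>f \<in> uedges G. e \<noteq> f \<longrightarrow> (\<exists>v \<in> S. edist G e v \<noteq> edist G f v))"

text \<open>
  In a finite simple graph the set of all vertices is edge resolving, so the minimum exists.
  For a graph with at most one edge the empty set is edge resolving and the value is \<open>0\<close>.
\<close>

definition edim :: "'a pair_pre_digraph \<Rightarrow> nat" where
  "edim G = (LEAST k. \<exists>S. edge_resolving G S \<and> card S = k)"

text \<open>The join \<open>G + K\<^sub>1\<close>; the new vertex is \<^const>\<open>None\<close>.\<close>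

definition join_K1 :: "'a pair_pre_digraph \<Rightarrow> 'a option pair_pre_digraph" where
  "join_K1 G =
     \<lparr> pverts = insert None (Some ` pverts G),
       parcs = map_prod Some Some ` parcs G
         \<union> {None} \<times> Some ` pverts G \<union> Some ` pverts G \<times> {None} \<rparr>"

lemma pair_graph_join_K1:
  assumes "pair_graph G"
  shows "pair_graph (join_K1 G)"
proof -
  interpret pair_graph G by fact
  have sym: "(v, u) \<in> parcs G" if "(u, v) \<in> parcs G" for u v
    using pair_sym_arcs that by (auto simp: symmetric_def dest: symD)
  show ?thesis
  proof unfold_locales
    show "symmetric (with_proj (join_K1 G))"
      by (auto simp: symmetric_def join_K1_def sym_def intro: sym rev_image_eqI)
  qed (use pair_finite_verts pair_finite_arcs pair_no_loops in
        \<open>auto simp: join_K1_def dest: in_arcsD1 in_arcsD2\<close>)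
qed

end

theory Submission
  imports Defs
begin

text \<open>
  In \<open>G + K\<^sub>1\<close> all distances are at most \<open>2\<close>. A vertex \<open>w\<close> of \<open>G\<close> separates the spokes at \<open>v\<close> and \<open>v'\<close>
  only if \<open>w \<in> {v, v'}\<close>, so a resolving set omits at most one vertex of \<open>G\<close>. Conversely the vertices
  of \<open>G\<close> are resolving, and when \<open>x\<close> is left out the only pairs that may become inseparable are the
  spoke at \<open>v\<close> and the edge \<open>xv\<close>, which happens exactly if every vertex other than \<open>x\<close> and \<open>v\<close> is
  adjacent to \<open>x\<close> or \<open>v\<close>, that is, \<open>V - N(x) \<subseteq> N(v)\<close>.
\<close>

section \<open>Preliminaries on walks, neighbourhoods and edges\<close>

lemma (in pair_wf_digraph) vdist_eqI:
  assumes "awalk u p v" and "\<And>q. awalk u q v \<Longrightarrow> length p \<le> length q"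
  shows "vdist G u v = ereal (length p)"
proof -
  \<comment> \<open>With unit weights the infimum defining \<open>vdist\<close> ranges over the
    lengths of walks, so a shortest walk attains it.\<close>
  have cost: "awalk_cost (\<lambda>_. 1) q = length q" for q
    by (induction q) auto
  show ?thesis
    unfolding vdist_def \<mu>_def
    by (rule INF_eqI) (use assms in \<open>auto simp: cost\<close>)
qed

lemma nbhd_sym:
  assumes "pair_graph G"
  shows "u \<in> nbhd G v \<longleftrightarrow> v \<in> nbhd G u"
proof -
  interpret pair_graph G by fact
  show ?thesis
    using pair_sym_arcs by (auto simp: nbhd_def symmetric_def dest: symD)
qed

lemma pverts_join_K1: "pverts (join_K1 G) = insert None (Some ` pverts G)"
  by (simp add: join_K1_def)

lemma nbhd_join_K1_None: "nbhd (join_K1 G) None = Some ` pverts G"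
  by (auto simp: join_K1_def nbhd_def)

lemma nbhd_join_K1_Some:
  "v \<in> pverts G \<Longrightarrow> nbhd (join_K1 G) (Some v) = insert None (Some ` nbhd G v)"
  by (auto simp: join_K1_def nbhd_def)

lemmas join_K1_simps = pverts_join_K1 nbhd_join_K1_None nbhd_join_K1_Some

lemma edge_resolvingD:
  assumes "edge_resolving G S"
  shows "S \<subseteq> pverts G"
    and "\<lbrakk>e \<in> uedges G; f \<in> uedges G; e \<noteq> f\<rbrakk> \<Longrightarrow> \<exists>v \<in> S. edist G e v \<noteq> edist G f v"
  using assms by (simp_all add: edge_resolving_def)

lemma uedgesD:
  assumes "pair_graph G" and "e \<in> uedges G"
  shows "e \<subseteq> pverts G" and "card e = 2"
proof -
  interpret pair_graph G by fact
  obtain x y where "e = {x, y}" "(x, y) \<in> parcs G"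
    using assms(2) by (auto simp: uedges_def)
  then show "e \<subseteq> pverts G" and "card e = 2"
    using pair_no_loops by (auto dest: in_arcsD1 in_arcsD2)
qed

text \<open>A two-element set inside a set of at most two elements must equal it. The inequality for
  \<open>B\<close> matters because \<open>B\<close> is later \<open>{u, x}\<close>, where
  \<open>u = x\<close> may hold.\<close>

lemma card_2_diff_nonempty:
  assumes "card A = 2" and "card B \<le> 2" and "finite B" and "A \<noteq> B"
  shows "\<exists>z. z \<in> A \<and> z \<notin> B"
  using card_seteq[of B A] assms by auto

section \<open>Distances and edges of the join\<close>

lemma vdist_join_K1:
  assumes "pair_graph G" and "u \<in> pverts (join_K1 G)" and "v \<in> pverts (join_K1 G)"
  shows "vdist (join_K1 G) u v = (if u = v then 0 else if v \<in> nbhd (join_K1 G) u then 1 else 2)"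
proof -
  interpret H: pair_graph "join_K1 G"
    using assms(1) by (rule pair_graph_join_K1)
  consider "u = v" | "u \<noteq> v" "(u, v) \<in> parcs (join_K1 G)" | "u \<noteq> v" "(u, v) \<notin> parcs (join_K1 G)"
    by blast
  then show ?thesis
  proof cases
    case 1
    have "vdist (join_K1 G) u v = ereal (length ([] :: ('a option \<times> 'a option) list))"
      by (rule H.vdist_eqI) (use 1 assms in \<open>auto simp: H.awalk_simps\<close>)
    then show ?thesis using 1 by (simp add: zero_ereal_def)
  next
    case 2
    have "vdist (join_K1 G) u v = ereal (length [(u, v)])"
    proof (rule H.vdist_eqI)
      fix q assume "H.awalk u q v"
      then show "length [(u, v)] \<le> length q"
        using 2 by (cases q) (auto simp: H.awalk_simps)
    qed (use 2 assms in \<open>auto simp: H.awalk_simps\<close>)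
    then show ?thesis using 2 by (simp add: nbhd_def one_ereal_def)
  next
    case 3
    \<comment> \<open>Both ends differ from \<open>None\<close>, which is adjacent to everything
      else, so the detour through \<open>None\<close> is a walk.\<close>
    have "vdist (join_K1 G) u v = ereal (length [(u, None), (None, v)])"
    proof (rule H.vdist_eqI)
      have "(u, None) \<in> parcs (join_K1 G)" "(None, v) \<in> parcs (join_K1 G)"
        using 3 assms by (auto simp: join_K1_def)
      then show "H.awalk u [(u, None), (None, v)] v"
        using assms by (auto simp: H.awalk_simps)
      fix q assume "H.awalk u q v"
      \<comment> \<open>The split is into no arc, one arc, and at least two arcs. The first would
        force \<open>u = v\<close>, the second an arc from \<open>u\<close> to
        \<open>v\<close>.\<close>
      then show "length [(u, None), (None, v)] \<le> length q"
        using 3 by (cases q rule: remdups_adj.cases) (auto simp: H.awalk_simps)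
    qed
    then show ?thesis using 3 by (simp add: nbhd_def numeral_eq_ereal)
  qed
qed

lemma uedges_join_K1:
  "uedges (join_K1 G) = (\<lambda>v. {None, Some v}) ` pverts G \<union> (`) Some ` uedges G"
    (is "_ = ?R")
proof (intro subset_antisym subsetI)
  fix e assume "e \<in> uedges (join_K1 G)"
  then obtain a b where e: "e = {a, b}" and "(a, b) \<in> parcs (join_K1 G)"
    unfolding uedges_def by blast
  then consider x y where "a = Some x" "b = Some y" "(x, y) \<in> parcs G"
    | v where "v \<in> pverts G" "{a, b} = {None, Some v}"
    by (auto simp: join_K1_def)
  then show "e \<in> ?R"
  proof cases
    case (1 x y)
    then have "e = Some ` {x, y}" "{x, y} \<in> uedges G"
      unfolding e uedges_def by auto
    then show ?thesis by blast
  next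
    case 2
    then show ?thesis unfolding e by blast
  qed
next
  fix e assume "e \<in> ?R"
  then consider v where "v \<in> pverts G" "e = {None, Some v}"
    | x y where "(x, y) \<in> parcs G" "e = Some ` {x, y}"
    unfolding uedges_def by blast
  then show "e \<in> uedges (join_K1 G)"
  proof cases
    case (1 v)
    then have "(None, Some v) \<in> parcs (join_K1 G)"
      by (simp add: join_K1_def)
    then show ?thesis
      unfolding uedges_def 1(2) by blast
  next
    case (2 x y)
    then have "(Some x, Some y) \<in> parcs (join_K1 G)"
      by (force simp: join_K1_def)
    moreover have "e = {Some x, Some y}"
      using 2(2) by simp
    ultimately show ?thesis
      unfolding uedges_def by blast
  qed
qed

section \<open>Distances from the edges of the join\<close>

lemma edist_spoke:
  assumes "pair_graph G" and "v \<in> pverts G" and "w \<in> pverts G"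
  shows "edist (join_K1 G) {None, Some v} (Some w) = (if w = v then 0 else 1)"
  using assms by (auto simp: edist_def vdist_join_K1 join_K1_simps)

lemma edist_spoke_None:
  assumes "pair_graph G" and "v \<in> pverts G"
  shows "edist (join_K1 G) {None, Some v} None = 0"
  using assms by (auto simp: edist_def vdist_join_K1 join_K1_simps)

text \<open>The value 2 never occurs for a spoke, so a vertex of \<open>G\<close> that is neither an
  end nor adjacent to one separates the edge from every spoke.\<close>

lemma edist_old_edge:
  assumes "pair_graph G" and "(x, y) \<in> parcs G" and "w \<in> pverts G"
  shows "edist (join_K1 G) {Some x, Some y} (Some w) =
    (if w = x \<or> w = y then 0 else if w \<in> nbhd G x \<union> nbhd G y then 1 else 2)"
proof -
  interpret pair_graph G by fact
  have "x \<in> pverts G" "y \<in> pverts G"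
    using assms by (auto dest: in_arcsD1 in_arcsD2)
  then show ?thesis
    using assms by (auto simp: edist_def vdist_join_K1 join_K1_simps)
qed

text \<open>Since distance 0 records incidence, any vertex of \<open>G\<close> on exactly one of two
  edges separates them.\<close>

lemma edist_eq_0_iff:
  assumes "pair_graph G" and "e \<in> uedges (join_K1 G)" and "w \<in> pverts G"
  shows "edist (join_K1 G) e (Some w) = 0 \<longleftrightarrow> Some w \<in> e"
  using assms by (auto simp: uedges_join_K1 edist_spoke) (auto simp: uedges_def edist_old_edge split: if_splits)

section \<open>Resolving sets of the join\<close>

lemma edge_resolving_join_K1_omits:
  assumes "pair_graph G" and "edge_resolving (join_K1 G) S"
    and "v \<in> pverts G" and "w \<in> pverts G" and "v \<noteq> w"
  shows "Some v \<in> S \<or> Some w \<in> S"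
proof -
  have "{None, Some v} \<in> uedges (join_K1 G)" "{None, Some w} \<in> uedges (join_K1 G)"
    "{None, Some v} \<noteq> {None, Some w}"
    using assms by (auto simp: uedges_join_K1 doubleton_eq_iff)
  then obtain z where z: "z \<in> S"
      "edist (join_K1 G) {None, Some v} z \<noteq> edist (join_K1 G) {None, Some w} z"
    using edge_resolvingD(2)[OF assms(2)] by blast
  moreover have "z \<in> pverts (join_K1 G)"
    using edge_resolvingD(1)[OF assms(2)] z(1) by blast
  \<comment> \<open>All spokes are at distance 0 from \<open>None\<close> and at distance 1 from
    each vertex of \<open>G\<close> other than their own end.\<close>
  ultimately have "z = Some v \<or> z = Some w"
    using assms by (cases z) (auto simp: edist_spoke edist_spoke_None join_K1_simps split: if_splits)
  then show ?thesis
    using z(1) by blast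
qed

lemma edge_resolving_join_K1_all:
  assumes "pair_graph G"
  shows "edge_resolving (join_K1 G) (Some ` pverts G)"
  unfolding edge_resolving_def
proof (intro conjI ballI impI)
  fix e f assume ef: "e \<in> uedges (join_K1 G)" "f \<in> uedges (join_K1 G)" "e \<noteq> f"
  have H: "pair_graph (join_K1 G)"
    using assms by (rule pair_graph_join_K1)
  have fin: "finite e" "finite f"
    using ef(1,2) by (auto simp: uedges_def)
  \<comment> \<open>Each edge has two ends, hence an end off the other edge. The two ends found
    differ, so at least one of them is not \<open>None\<close>.\<close>
  obtain p q where "p \<in> e - f" "q \<in> f - e"
    using card_2_diff_nonempty[of e f] card_2_diff_nonempty[of f e] uedgesD[OF H] ef fin by auto
  then obtain w where "w \<in> pverts G" "Some w \<in> e \<longleftrightarrow> Some w \<notin> f"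
    using uedgesD(1)[OF H] ef(1,2) unfolding pverts_join_K1 by blast
  then show "\<exists>v\<in>Some ` pverts G. edist (join_K1 G) e v \<noteq> edist (join_K1 G) f v"
    using edist_eq_0_iff[OF assms ef(1), of w] edist_eq_0_iff[OF assms ef(2), of w]
    by (intro bexI[of _ "Some w"]) auto
qed (auto simp: join_K1_simps)

lemma edge_resolving_join_K1_omit:
  assumes "pair_graph G" and "x \<in> pverts G"
  shows "edge_resolving (join_K1 G) (Some ` (pverts G - {x})) \<longleftrightarrow>
    \<not> (\<exists>u \<in> pverts G. u \<noteq> x \<and> pverts G - nbhd G x \<subseteq> nbhd G u)"
    (is "?L \<longleftrightarrow> \<not> ?R")
proof
  interpret pair_graph G by fact
  assume ?L
  show "\<not> ?R"
  proof
    assume ?R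
    then obtain u where u: "u \<in> pverts G" "u \<noteq> x" "pverts G - nbhd G x \<subseteq> nbhd G u"
      by blast
    \<comment> \<open>As \<open>x\<close> lies outside its own neighbourhood, the choice of
      \<open>u\<close> makes \<open>u\<close> and \<open>x\<close> adjacent, so the edge to be
      compared with the spoke at \<open>u\<close> exists.\<close>
    have "x \<notin> nbhd G x"
      using pair_no_loops[of "(x, x)"] by (auto simp: nbhd_def)
    then have ux: "(u, x) \<in> parcs G"
      using u assms by (auto simp: nbhd_def)
    then have "{u, x} \<in> uedges G"
      unfolding uedges_def by blast
    then have "Some ` {u, x} \<in> uedges (join_K1 G)"
      unfolding uedges_join_K1 by (rule UnI2[OF imageI])
    then have "{Some u, Some x} \<in> uedges (join_K1 G)"
      by simp
    moreover have "{None, Some u} \<in> uedges (join_K1 G)"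
      using u assms by (simp add: uedges_join_K1)
    moreover have "{None, Some u} \<noteq> {Some u, Some x}"
      by auto
    ultimately obtain w where "w \<in> pverts G" "w \<noteq> x"
        "edist (join_K1 G) {None, Some u} (Some w) \<noteq> edist (join_K1 G) {Some u, Some x} (Some w)"
      using edge_resolvingD(2)[OF \<open>?L\<close>] by blast
    \<comment> \<open>At \<open>w = u\<close> both distances are 0; any other \<open>w\<close> is
      adjacent to \<open>x\<close> or \<open>u\<close>, so both are 1.\<close>
    then show False
      using u ux assms by (auto simp: edist_spoke edist_old_edge split: if_splits)
  qed
next
  interpret pair_graph G by fact
  assume nR: "\<not> ?R"
  have spoke_edge: "\<exists>w \<in> pverts G - {x}.
      edist (join_K1 G) {None, Some u} (Some w) \<noteq> edist (join_K1 G) (Some ` f) (Some w)"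
    if u: "u \<in> pverts G" and f: "f \<in> uedges G" for u f
  proof (cases "f = {u, x}")
    case True
    with f have "(u, x) \<in> parcs G \<or> (x, u) \<in> parcs G"
      by (auto simp: uedges_def doubleton_eq_iff)
    then have ux: "(u, x) \<in> parcs G"
      using nbhd_sym[OF assms(1), of u x] by (auto simp: nbhd_def)
    then have "u \<noteq> x"
      using pair_no_loops by fastforce
    \<comment> \<open>This \<open>w\<close> is adjacent to neither end, hence is neither end, as
      \<open>u\<close> and \<open>x\<close> are adjacent. It is at distance 1 from the spoke and 2
      from the edge.\<close>
    with nR u obtain w where w: "w \<in> pverts G" "w \<notin> nbhd G x" "w \<notin> nbhd G u"
      by blast
    have "u \<in> nbhd G x" "x \<in> nbhd G u"
      using ux nbhd_sym[OF assms(1), of u x] by (auto simp: nbhd_def)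
    with w have "w \<noteq> x" "w \<noteq> u" by auto
    with w ux u assms True show ?thesis
      by (intro bexI[of _ w]) (auto simp: edist_spoke edist_old_edge)
  next
    case False
    \<comment> \<open>Only an upper bound is available, as \<open>u = x\<close> is possible. An end
      of \<open>f\<close> outside \<open>{u, x}\<close> lies on the old edge but not on the
      spoke.\<close>
    have "card {u, x} \<le> 2"
      using card_insert_le_m1[of 2 "{x}" u] by simp
    then obtain w where w: "w \<in> f" "w \<noteq> u" "w \<noteq> x"
      using card_2_diff_nonempty[of f "{u, x}"] uedgesD(2)[OF assms(1) f] False by auto
    have "{None, Some u} \<in> uedges (join_K1 G)" "Some ` f \<in> uedges (join_K1 G)"
      using u f assms by (auto simp: uedges_join_K1)
    moreover have wV: "w \<in> pverts G"
      using w uedgesD(1)[OF assms(1) f] by blast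
    ultimately have "edist (join_K1 G) {None, Some u} (Some w) \<noteq> 0"
      "edist (join_K1 G) (Some ` f) (Some w) = 0"
      using w edist_eq_0_iff[OF assms(1)] by auto
    then show ?thesis
      using w wV by (intro bexI[of _ w]) auto
  qed
  show ?L
    unfolding edge_resolving_def
  proof (intro conjI ballI impI)
    fix e f assume ef: "e \<in> uedges (join_K1 G)" "f \<in> uedges (join_K1 G)" "e \<noteq> f"
    have "\<exists>w \<in> pverts G - {x}. edist (join_K1 G) e (Some w) \<noteq> edist (join_K1 G) f (Some w)"
    proof -
      consider (spokes) u v where "u \<in> pverts G" "v \<in> pverts G" "e = {None, Some u}" "f = {None, Some v}"
        | (mixed1) u f' where "u \<in> pverts G" "f' \<in> uedges G" "e = {None, Some u}" "f = Some ` f'"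
        | (mixed2) u e' where "u \<in> pverts G" "e' \<in> uedges G" "f = {None, Some u}" "e = Some ` e'"
        | (old) e' f' where "e' \<in> uedges G" "f' \<in> uedges G" "e = Some ` e'" "f = Some ` f'"
        using ef(1,2) unfolding uedges_join_K1 by blast
      then show ?thesis
      proof cases
        case spokes
        \<comment> \<open>One of the distinct vertices \<open>u\<close> and \<open>v\<close> is not
          \<open>x\<close>; it is at distance 0 from its own spoke and 1 from the other.\<close>
        then show ?thesis
          using ef(3) assms by (cases "u = x") (auto simp: edist_spoke)
      next
        case mixed1
        then show ?thesis using spoke_edge by blast
      next
        case mixed2
        from spoke_edge[OF mixed2(1,2)] show ?thesis
          unfolding mixed2(3,4) by (elim bexE) (rule bexI, erule not_sym)
      next
        case old
        then have "e' \<noteq> f'" using ef by auto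
        moreover have "finite e'" "finite f'"
          using old(1,2) by (auto simp: uedges_def)
        ultimately obtain p q where "p \<in> e' - f'" "q \<in> f' - e'"
          using card_2_diff_nonempty[of e' f'] card_2_diff_nonempty[of f' e']
            uedgesD(2)[OF assms(1)] old(1,2) by auto
        \<comment> \<open>Since \<open>p\<close> and \<open>q\<close> differ, at least one of them
          survives the removal of \<open>x\<close>.\<close>
        then obtain w where "w \<in> pverts G - {x}" "w \<in> e' \<longleftrightarrow> w \<notin> f'"
          using uedgesD(1)[OF assms(1)] old(1,2) by blast
        then have "edist (join_K1 G) e (Some w) = 0 \<longleftrightarrow> edist (join_K1 G) f (Some w) \<noteq> 0"
          using old(3,4) ef edist_eq_0_iff[OF assms(1)] by auto
        then show ?thesis
          using \<open>w \<in> pverts G - {x}\<close> by metis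
      qed
    qed
    then show "\<exists>v\<in>Some ` (pverts G - {x}). edist (join_K1 G) e v \<noteq> edist (join_K1 G) f v"
      by blast
  qed (auto simp: join_K1_simps)
qed

section \<open>Counting: lower bounds and their attainment\<close>

theorem theorem4p1:
  fixes G :: "'a pair_pre_digraph" and n :: nat
  assumes "pair_graph G"
    and "Digraph_Component.connected (with_proj G)"
    and "card (pverts G) = n"
  shows "((\<forall>x \<in> pverts G. \<exists>u \<in> pverts G. u \<noteq> x \<and> pverts G - nbhd G x \<subseteq> nbhd G u)
            \<longrightarrow> edim (join_K1 G) = n)
       \<and> (\<not> (\<forall>x \<in> pverts G. \<exists>u \<in> pverts G. u \<noteq> x \<and> pverts G - nbhd G x \<subseteq> nbhd G u)
            \<longrightarrow> edim (join_K1 G) = n - 1)"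
proof -
  interpret pair_graph G by fact
  let ?P = "\<lambda>k. \<exists>S. edge_resolving (join_K1 G) S \<and> card S = k"
  have card_Some: "card (Some ` A) = card A" for A :: "'a set"
    by (simp add: card_image)
  have fin: "finite S" if "edge_resolving (join_K1 G) S" for S
    using that pair_finite_verts
    by (auto simp: edge_resolving_def join_K1_simps intro: finite_subset)
  \<comment> \<open>Inclusions rather than equations, because \<open>S\<close> may also contain
    \<open>None\<close>.\<close>
  have large: "Some ` pverts G \<subseteq> S \<or> (\<exists>x \<in> pverts G. Some ` (pverts G - {x}) \<subseteq> S)"
    if "edge_resolving (join_K1 G) S" for S
  proof (cases "Some ` pverts G \<subseteq> S")
    case False
    then obtain x where "x \<in> pverts G" "Some x \<notin> S"
      by blast
    then show ?thesis
      using edge_resolving_join_K1_omits[OF assms(1) that, of x] by blast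
  qed simp
  \<comment> \<open>Since \<open>x\<close> is a vertex, \<open>n\<close> is positive and the
    subtraction does not truncate.\<close>
  have card_omit: "card (Some ` (pverts G - {x})) = n - 1" if "x \<in> pverts G" for x
    using that assms(3) by (simp add: card_Some)
  have ge: "n - 1 \<le> card S" if "edge_resolving (join_K1 G) S" for S
    using large[OF that]
  proof
    assume "Some ` pverts G \<subseteq> S"
    from card_mono[OF fin[OF that] this] show ?thesis
      by (simp add: card_Some assms(3))
  next
    assume "\<exists>x \<in> pverts G. Some ` (pverts G - {x}) \<subseteq> S"
    then obtain x where x: "x \<in> pverts G" "Some ` (pverts G - {x}) \<subseteq> S"
      by blast
    from card_mono[OF fin[OF that] x(2)] show ?thesis
      unfolding card_omit[OF x(1)] .
  qed
  have full: "?P n"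
    by (intro exI[of _ "Some ` pverts G"])
      (simp add: edge_resolving_join_K1_all[OF assms(1)] card_Some assms(3))
  show ?thesis
  proof (intro conjI impI)
    assume bad: "\<forall>x \<in> pverts G. \<exists>u \<in> pverts G. u \<noteq> x \<and> pverts G - nbhd G x \<subseteq> nbhd G u"
    have "n \<le> card S" if S: "edge_resolving (join_K1 G) S" for S
      using large[OF S]
    proof
      assume "Some ` pverts G \<subseteq> S"
      from card_mono[OF fin[OF S] this] show ?thesis
        by (simp add: card_Some assms(3))
    next
      assume "\<exists>x \<in> pverts G. Some ` (pverts G - {x}) \<subseteq> S"
      then obtain x where x: "x \<in> pverts G" "Some ` (pverts G - {x}) \<subseteq> S"
        by blast
      \<comment> \<open>So \<open>S\<close> contains something more, be it \<open>Some x\<close> or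
        \<open>None\<close>: taking the apex in place of \<open>x\<close> saves nothing.\<close>
      moreover have "S \<noteq> Some ` (pverts G - {x})"
        using S x(1) bad edge_resolving_join_K1_omit[OF assms(1) x(1)] by auto
      ultimately have "n - 1 < card S"
        using psubset_card_mono[OF fin[OF S], of "Some ` (pverts G - {x})"] card_omit[OF x(1)]
        by auto
      then show ?thesis by linarith
    qed
    then show "edim (join_K1 G) = n"
      unfolding edim_def using full by (intro Least_equality) auto
  next
    assume "\<not> (\<forall>x \<in> pverts G. \<exists>u \<in> pverts G. u \<noteq> x \<and> pverts G - nbhd G x \<subseteq> nbhd G u)"
    then obtain x where "x \<in> pverts G"
        "\<not> (\<exists>u \<in> pverts G. u \<noteq> x \<and> pverts G - nbhd G x \<subseteq> nbhd G u)"
      by blast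
    \<comment> \<open>Such an \<open>x\<close> can be left out, which attains the bound
      \<open>ge\<close>.\<close>
    then have "?P (n - 1)"
      using edge_resolving_join_K1_omit[OF assms(1), of x] card_omit by blast
    then show "edim (join_K1 G) = n - 1"
      unfolding edim_def using ge by (intro Least_equality) auto
  qed
qed

end
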